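(* Let $\mathcal{B}$ be Bring's curve $\{\sum_{i=1}^5 x_i=\sum_{i=1}^5x_i^2=\sum_{i=1}^5x_i^3=0\}\subset\mathbb{P}^4$ over $\mathbb{C}$. The vertices of $\mathcal{B}$ are exactly the points fixed by an order-$4$ automorphism of the curve. They are given in this $\mathbb{P}^4$-model by the permutations of $[1:i:-1:-i:0]$.
   Context: $\mathrm{Aut}(\mathcal{B})=S_5$ acting by permutation of coordinates. Orbits of $\mathrm{Aut}(\mathcal{B})$ on $\mathcal{B}$ of size less than $120$ are exactly three, of sizes $24$, $30$, $60$; they are identified with the face-centres (24), vertices (30) and edge-centres (60) of the regular map $\{5,4\}_6$ on $\mathcal{B}$ (a tessellation by 24 pentagons, four meeting at each vertex, with orientation-preserving automorphism group $\mathrm{Aut}(\mathcal{B})$). So the vertices form the orbit of size $30$. *)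

theory Defs
  imports
    "HOL-Analysis.Analysis"
    "HOL-Algebra.Bij"
    "HOL-Algebra.Multiplicative_Group"
    "HOL-Algebra.Group_Action"
begin

text \<open>A point of complex projective space is the line through the origin
  spanned by a nonzero vector \<open>x\<close> of homogeneous coordinates, i.e. \<open>[x] = vec.span {x}\<close>
  (the span over the complex numbers).\<close>

abbreviation proj_point :: "complex ^ 'n \<Rightarrow> (complex ^ 'n) set" where
  "proj_point x \<equiv> vec.span {x}"

definition bring_curve :: "(complex ^ 5) set set" where
  "bring_curve = {proj_point x | x. x \<noteq> 0 \<and>
     (\<Sum>i\<in>UNIV. x $ i) = 0 \<and> (\<Sum>i\<in>UNIV. (x $ i)\<^sup>2) = 0 \<and> (\<Sum>i\<in>UNIV. (x $ i) ^ 3) = 0}"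

text \<open>Homogeneous polynomials of a given degree in the coordinates, as functions
  (zero is homogeneous of every degree).\<close>

inductive homogeneous_poly :: "nat \<Rightarrow> (complex ^ 'n \<Rightarrow> complex) \<Rightarrow> bool" where
  const: "homogeneous_poly 0 (\<lambda>x. c)"
| coord: "homogeneous_poly 1 (\<lambda>x. x $ i)"
| add: "homogeneous_poly d f \<Longrightarrow> homogeneous_poly d g \<Longrightarrow> homogeneous_poly d (\<lambda>x. f x + g x)"
| mult: "homogeneous_poly d f \<Longrightarrow> homogeneous_poly e g \<Longrightarrow> homogeneous_poly (d + e) (\<lambda>x. f x * g x)"

text \<open>Morphisms of projective varieties: Zariski-locally, \<open>f\<close> is given by a tuple \<open>F\<close> of
  homogeneous polynomials of one common degree without common zero. No separate
  Zariski-open neighbourhood is needed: multiplying \<open>F\<close> by a homogeneous polynomial \<open>h\<close>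
  shrinks the set where \<open>F\<close> does not vanish to its intersection with the set \<open>h \<noteq> 0\<close>.\<close>

definition regular_map_on ::
    "(complex ^ 'n) set set \<Rightarrow> ((complex ^ 'n) set \<Rightarrow> (complex ^ 'n) set) \<Rightarrow> bool" where
  "regular_map_on X f \<longleftrightarrow>
     (\<forall>p\<in>X. \<exists>d F. (\<forall>i. homogeneous_poly d (\<lambda>x. F x $ i)) \<and>
        (\<exists>x. p = proj_point x \<and> F x \<noteq> 0) \<and>
        (\<forall>x. proj_point x \<in> X \<and> F x \<noteq> 0 \<longrightarrow> f (proj_point x) = proj_point (F x)))"

definition aut_group :: "(complex ^ 'n) set set \<Rightarrow> ((complex ^ 'n) set \<Rightarrow> (complex ^ 'n) set) monoid" where
  "aut_group X = (BijGroup X) \<lparr>carrier :=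
     {f \<in> Bij X. regular_map_on X f \<and> regular_map_on X (restrict (inv_into X f) X)}\<rparr>"

definition permute_coords :: "('n \<Rightarrow> 'n) \<Rightarrow> complex ^ 'n \<Rightarrow> complex ^ 'n" where
  "permute_coords \<sigma> x = (\<chi> i. x $ \<sigma> i)"

definition coord_perm_maps :: "((complex ^ 5) set \<Rightarrow> (complex ^ 5) set) set" where
  "coord_perm_maps = {restrict ((`) (permute_coords \<sigma>)) bring_curve | \<sigma>. \<sigma> permutes UNIV}"

text \<open>The vertices of the regular map \<open>{5,4}_6\<close> on Bring's curve are the points of the orbit
  of size 30 of the automorphism group (the face-centres and edge-centres being
  those of sizes 24 and 60).\<close>

definition bring_vertices :: "(complex ^ 5) set set" where
  "bring_vertices =
     {p \<in> bring_curve. card (orbit (aut_group bring_curve) (\<lambda>f. f) p) = 30}"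

end

theory Submission
  imports
    Defs
    "HOL-Computational_Algebra.Polynomial"
    "HOL-Combinatorics.Cycles"
begin

text \<open>
The first three power sums of the coordinates of a point \<open>[x]\<close> of Bring's curve vanish, so by
Newton's identities the coordinates are the roots, in some order and with multiplicity, of a
trinomial \<open>t ^ 5 + a t + b\<close> (\<open>coord_poly_bring\<close>). Everything depends on whether \<open>b = 0\<close>, that is, on
whether some coordinate vanishes.

If \<open>b = 0\<close>, rescaling turns the trinomial into \<open>t ^ 5 - t\<close>, with roots \<open>0, 1, \<i>, -1, -\<i>\<close>, and the
point is a permutation of \<open>[1 : \<i> : -1 : -\<i> : 0]\<close> (\<open>zero_coord_imp_vertex\<close>). Its stabilizer among the
coordinate permutations consists of the four multiplications of this root set by fourth roots of
unity. It has order \<open>4\<close>, hence the orbit has size \<open>120 / 4 = 30\<close>, and multiplication by \<open>\<i>\<close> is an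
element of order \<open>4\<close> in it (\<open>card_proj_stabilizer_vertex\<close>, \<open>vertex_fixed_by_order_4\<close>).

If \<open>b \<noteq> 0\<close>, a permutation \<open>\<sigma>\<close> that fixes the point scales \<open>x\<close> by a fifth root of unity, because it
preserves the product of the coordinates. If also \<open>\<sigma> ^^ 4 = id\<close>, the factor is a fourth root of
unity, so it is \<open>1\<close> and \<open>\<sigma>\<close> only exchanges equal coordinates. As \<open>t ^ 5 + a t + b\<close> has at most one
multiple root, and that a double one, \<open>\<sigma>\<close> is the identity or one particular transposition
(\<open>nonvertex_stabilizer\<close>). Hence no automorphism of order \<open>4\<close> fixes the point, and by Lagrange's
theorem its stabilizer cannot have order \<open>4\<close>, so its orbit does not have size \<open>30\<close>.

That the coordinate permutations are automorphisms and act faithfully, so that they form a group of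
order \<open>120\<close>, is checked directly (\<open>coord_perm_maps_subset_aut\<close>, \<open>perm_map_inj\<close>); that there are no
other automorphisms is the hypothesis of the theorem.
\<close>

section \<open>The coordinates of the vertices\<close>

text \<open>The distinct coordinates \<open>0, 1, \<i>, -1, -\<i>\<close> of a vertex, described as the roots of \<open>t ^ 5 - t\<close>:
in this form it is evident that they are closed under multiplication.\<close>

definition vertex_coords :: "complex set" where
  "vertex_coords = {z. z ^ 5 = z}"

lemma vertex_coords_eq: "vertex_coords = {0, 1, \<i>, -1, -\<i>}"
proof -
  have "z ^ 5 = z \<longleftrightarrow> z \<in> {0, 1, \<i>, -1, -\<i>}" for z :: complex
  proof -
    have "z ^ 5 - z = z * (z - 1) * (z + 1) * (z - \<i>) * (z + \<i>)"
      by (simp add: algebra_simps eval_nat_numeral)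
    then have "z ^ 5 = z \<longleftrightarrow> z * (z - 1) * (z + 1) * (z - \<i>) * (z + \<i>) = 0"
      by (metis right_minus_eq)
    then show ?thesis
      by (auto simp: eq_neg_iff_add_eq_0)
  qed
  then show ?thesis by (auto simp: vertex_coords_def)
qed

lemma zero_in_vertex_coords: "0 \<in> vertex_coords"
  by (simp add: vertex_coords_def)

lemma card_vertex_coords: "card vertex_coords = 5" "finite vertex_coords"
  by (auto simp: vertex_coords_eq complex_eq_iff)

lemma UNIV_5: "(UNIV :: 5 set) = {1, 2, 3, 4, 5}"
  (is "_ = ?S")
proof -
  have "card ?S = CARD(5)"
    by simp
  then show ?thesis
    by (metis finite card_subset_eq subset_UNIV)
qed

lemma sum_5: "sum f (UNIV :: 5 set) = f 1 + f 2 + f 3 + f 4 + f 5"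
  unfolding UNIV_5 by (simp add: ac_simps)

lemma prod_5: "prod f (UNIV :: 5 set) = f 1 * f 2 * f 3 * f 4 * f 5"
  unfolding UNIV_5 by (simp add: ac_simps)

lemma bring_vector_coords:
  fixes v :: "complex ^ 5"
  assumes "v = vector [1, \<i>, -1, -\<i>, 0]"
  shows "bij_betw (($) v) UNIV vertex_coords"
proof -
  have "v $ 1 = 1 \<and> v $ 2 = \<i> \<and> v $ 3 = -1 \<and> v $ 4 = -\<i> \<and> v $ 5 = 0"
    by (simp add: assms vector_def)
  then have img: "($) v ` UNIV = vertex_coords"
    unfolding UNIV_5 vertex_coords_eq by auto
  moreover from img have "inj (($) v)"
    by (intro eq_card_imp_inj_on) (simp_all add: card_vertex_coords)
  ultimately show ?thesis
    by (simp add: bij_betw_def)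
qed

section \<open>The coordinates of a point as roots of a quintic\<close>

definition bring_equations :: "complex ^ 5 \<Rightarrow> bool" where
  "bring_equations x \<longleftrightarrow>
     (\<Sum>i\<in>UNIV. x $ i) = 0 \<and> (\<Sum>i\<in>UNIV. (x $ i)\<^sup>2) = 0 \<and> (\<Sum>i\<in>UNIV. (x $ i) ^ 3) = 0"

text \<open>A vector is determined, up to the order of its coordinates, by this polynomial. Coincidences of
coordinates are multiple roots, so they are seen by the derivatives.\<close>

definition coord_poly :: "complex ^ 'n \<Rightarrow> complex poly" where
  "coord_poly x = (\<Prod>i\<in>UNIV. [:- x $ i, 1:])"

lemma coord_poly_root: "poly (coord_poly x) (x $ i) = 0"
  by (auto simp: coord_poly_def poly_prod)

lemma elementary_symmetric_2_3_eq_0: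
  fixes p q r s t :: complex
  assumes 1: "p + q + r + s + t = 0"
    and 2: "p\<^sup>2 + q\<^sup>2 + r\<^sup>2 + s\<^sup>2 + t\<^sup>2 = 0"
    and 3: "p ^ 3 + q ^ 3 + r ^ 3 + s ^ 3 + t ^ 3 = 0"
  shows "p*q + p*r + p * s + p*t + q*r + q * s + q*t + r * s + r*t + s*t = 0" (is "?e2 = 0")
    and "p*q*r + p*q * s + p*q*t + p*r * s + p*r*t + p * s*t + q*r * s + q*r*t + q * s*t + r * s*t = 0"
      (is "?e3 = 0")
proof -
  have "2 * ?e2 = (p + q + r + s + t)\<^sup>2 - (p\<^sup>2 + q\<^sup>2 + r\<^sup>2 + s\<^sup>2 + t\<^sup>2)"
    by (simp add: algebra_simps power2_eq_square)
  then have "2 * ?e2 = 0" by (simp only: 1 2) simp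
  then show e2: "?e2 = 0" by (metis mult_eq_0_iff zero_neq_numeral)
  have "3 * ?e3 = (p ^ 3 + q ^ 3 + r ^ 3 + s ^ 3 + t ^ 3)
      - (p + q + r + s + t) * (p\<^sup>2 + q\<^sup>2 + r\<^sup>2 + s\<^sup>2 + t\<^sup>2)
      + (p + q + r + s + t) * ?e2"
    by (simp add: algebra_simps power2_eq_square power3_eq_cube)
  then have "3 * ?e3 = 0" by (simp only: 1 2 3 e2) simp
  then show "?e3 = 0" by (metis mult_eq_0_iff zero_neq_numeral)
qed

text \<open>By Newton's identities, the vanishing of the first three power sums is the vanishing of the first
three elementary symmetric functions, which are up to sign the coefficients of \<open>t ^ 4\<close>, \<open>t ^ 3\<close>
and \<open>t\<^sup>2\<close>. Points of Bring's curve are thus orderings of the roots of trinomials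
\<open>t ^ 5 + a t + b\<close>.\<close>

lemma coord_poly_bring:
  assumes "bring_equations x"
  obtains a where "coord_poly x = [:- (\<Prod>i\<in>UNIV. x $ i), a, 0, 0, 0, 1:]"
proof -
  define p q r s t where "p = x $ 1" and "q = x $ 2" and "r = x $ 3" and "s = x $ 4" and "t = x $ 5"
  note coords = this
  have e: "p + q + r + s + t = 0" "p\<^sup>2 + q\<^sup>2 + r\<^sup>2 + s\<^sup>2 + t\<^sup>2 = 0"
    "p ^ 3 + q ^ 3 + r ^ 3 + s ^ 3 + t ^ 3 = 0"
    using assms by (simp_all only: bring_equations_def sum_5 coords)
  have "coord_poly x = [:-p,1:] * [:-q,1:] * [:-r,1:] * [:-s,1:] * [:-t,1:]"
    by (simp only: coord_poly_def prod_5 coords)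
  also have "\<dots> = [:- (p*q*r * s*t),
      p*q*r * s + p*q*r*t + p*q * s*t + p*r * s*t + q*r * s*t,
      - (p*q*r + p*q * s + p*q*t + p*r * s + p*r*t + p * s*t + q*r * s + q*r*t + q * s*t + r * s*t),
      p*q + p*r + p * s + p*t + q*r + q * s + q*t + r * s + r*t + s*t,
      - (p + q + r + s + t), 1:]"
    by (simp add: algebra_simps)
  also have "\<dots> = [:- (p*q*r * s*t),
      p*q*r * s + p*q*r*t + p*q * s*t + p*r * s*t + q*r * s*t, 0, 0, 0, 1:]"
    by (simp only: elementary_symmetric_2_3_eq_0[OF e] e(1) minus_zero)
  finally show thesis
    unfolding coords prod_5[of "($) x", symmetric] by (rule that)
qed

lemma power_Suc_dvd_imp_power_dvd_pderiv:
  fixes p q :: "'a :: idom poly"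
  assumes "p ^ Suc n dvd q"
  shows "p ^ n dvd pderiv q"
proof -
  obtain r where q: "q = p ^ Suc n * r" using assms by blast
  show ?thesis
    unfolding q pderiv_mult pderiv_power_Suc
    by (intro dvd_add dvd_smult dvd_mult dvd_mult2) (simp_all add: dvd_smult)
qed

lemma coord_poly_multiplicity:
  assumes "finite A" "\<And>i. i \<in> A \<Longrightarrow> x $ i = u"
  shows "[:- u, 1:] ^ card A dvd coord_poly x"
proof -
  have "(\<Prod>i\<in>A. [:- x $ i, 1:]) dvd coord_poly x"
    unfolding coord_poly_def by (rule prod_dvd_prod_subset) auto
  then show ?thesis using assms by simp
qed

lemma double_coord:
  assumes "i \<noteq> j" "x $ i = x $ j"
  shows "poly (pderiv (coord_poly x)) (x $ i) = 0"
proof -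
  have "[:- x $ i, 1:] ^ card {i, j} dvd coord_poly x"
    by (rule coord_poly_multiplicity) (use assms in auto)
  moreover have "card {i, j} = Suc 1" using assms by simp
  ultimately have "[:- x $ i, 1:] ^ Suc 1 dvd coord_poly x" by (simp only:)
  from power_Suc_dvd_imp_power_dvd_pderiv[OF this] show ?thesis
    by (simp add: poly_eq_0_iff_dvd)
qed

lemma triple_coord:
  assumes "i \<noteq> j" "i \<noteq> k" "j \<noteq> k" "x $ i = x $ j" "x $ i = x $ k"
  shows "poly (pderiv (pderiv (coord_poly x))) (x $ i) = 0"
proof -
  have "[:- x $ i, 1:] ^ card {i, j, k} dvd coord_poly x"
    by (rule coord_poly_multiplicity) (use assms in auto)
  moreover have "card {i, j, k} = Suc (Suc 1)" using assms by simp
  ultimately have "[:- x $ i, 1:] ^ Suc (Suc 1) dvd coord_poly x" by (simp only:)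
  from this[THEN power_Suc_dvd_imp_power_dvd_pderiv, THEN power_Suc_dvd_imp_power_dvd_pderiv]
  show ?thesis
    by (simp add: poly_eq_0_iff_dvd)
qed

text \<open>Here the trinomial is \<open>t ^ 5 + a t\<close>. It is separable because \<open>a \<noteq> 0\<close>, and its nonzero roots
have the same fourth power \<open>-a\<close>; dividing by one of them turns it into \<open>t ^ 5 - t\<close>.\<close>

lemma zero_coord_imp_vertex:
  assumes "bring_equations x" "x \<noteq> 0" "(\<Prod>i\<in>UNIV. x $ i) = 0"
  obtains c where "c \<noteq> 0" "bij_betw (($) (c *s x)) UNIV vertex_coords"
proof -
  obtain a where a: "coord_poly x = [:0, a, 0, 0, 0, 1:]"
    using coord_poly_bring[OF assms(1)] unfolding assms(3) minus_zero by blast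
  have root: "x $ i * (x $ i ^ 4 + a) = 0" for i
    using coord_poly_root[of x i] unfolding a by (simp add: algebra_simps eval_nat_numeral)
  obtain m where m: "x $ m \<noteq> 0" using assms(2) by (auto simp: vec_eq_iff)
  define c where "c = x $ m"
  \<comment> \<open>In particular \<open>a \<noteq> 0\<close>, so a root cannot also be a root of the derivative.\<close>
  have am: "a = - (c ^ 4)" using root[of m] m by (simp add: c_def eq_neg_iff_add_eq_0 add.commute)
  have inj: "inj (($) x)"
  proof (rule injI, rule ccontr)
    fix i j assume ij: "x $ i = x $ j" "i \<noteq> j"
    have "5 * x $ i ^ 4 + a = 0"
      using double_coord[OF ij(2,1)] unfolding a
      by (simp add: pderiv_pCons algebra_simps eval_nat_numeral)
    moreover have "x $ i = 0 \<or> a = - (x $ i ^ 4)"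
      using root[of i] by (auto simp: eq_neg_iff_add_eq_0 add.commute)
    ultimately show False using am m by (auto simp: c_def)
  qed
  define y where "y = inverse c *s x"
  have c0: "c \<noteq> 0" using m by (simp add: c_def)
  have "y $ i \<in> vertex_coords" for i
  proof -
    have "x $ i ^ 5 = c ^ 4 * x $ i"
      using root[of i] am by (simp add: algebra_simps eval_nat_numeral)
    then show ?thesis using c0
      by (simp add: vertex_coords_def y_def power_mult_distrib field_simps eval_nat_numeral)
  qed
  then have sub: "($) y ` UNIV \<subseteq> vertex_coords" by auto
  have injy: "inj (($) y)"
    using inj c0 by (simp add: inj_def y_def)
  then have "card (($) y ` UNIV) = card vertex_coords"
    by (simp add: card_image card_vertex_coords)
  then have "($) y ` UNIV = vertex_coords"
    using sub card_vertex_coords(2) card_subset_eq by blast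
  then show thesis
    using that[of "inverse c"] c0 injy by (simp add: y_def bij_betw_def)
qed

text \<open>A double root of \<open>t ^ 5 + a t + b\<close> is also a root of
\<open>5 (t ^ 5 + a t + b) - t (5 t ^ 4 + a) = 4 a t + 5 b\<close>, so for \<open>b \<noteq> 0\<close> there is at most one; the
second derivative \<open>20 t ^ 3\<close> excludes a triple root. If all coordinates are distinct, any
\<open>i = j\<close> will do.\<close>

lemma nonzero_coords_at_most_one_coincidence:
  assumes "bring_equations x" "(\<Prod>i\<in>UNIV. x $ i) \<noteq> 0"
  obtains i j where "\<And>k l. x $ k = x $ l \<Longrightarrow> k = l \<or> {k, l} = {i, j}"
proof -
  define b where "b = - (\<Prod>i\<in>UNIV. x $ i)"
  obtain a where a: "coord_poly x = [:b, a, 0, 0, 0, 1:]"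
    using coord_poly_bring[OF assms(1)] unfolding b_def by blast
  have b: "b \<noteq> 0"
    using assms(2) by (simp add: b_def)
  have nz: "x $ k \<noteq> 0" for k using assms(2) by auto
  have root: "x $ k ^ 5 + a * x $ k + b = 0" for k
    using coord_poly_root[of x k] unfolding a by (simp add: algebra_simps eval_nat_numeral)
  have dbl: "4 * a * x $ k + 5 * b = 0" if "x $ k = x $ l" "k \<noteq> l" for k l
  proof -
    have "5 * x $ k ^ 4 + a = 0"
      using double_coord[OF that(2,1)] unfolding a
      by (simp add: pderiv_pCons algebra_simps eval_nat_numeral)
    moreover have "4 * a * x $ k + 5 * b = 5 * (x $ k ^ 5 + a * x $ k + b) - x $ k * (5 * x $ k ^ 4 + a)"
      by (simp add: algebra_simps eval_nat_numeral)
    ultimately show ?thesis using root[of k] by simp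
  qed
  have tri: False if "x $ k = x $ l" "x $ k = x $ m" "k \<noteq> l" "k \<noteq> m" "l \<noteq> m" for k l m
    using triple_coord[OF that(3-5) that(1,2)] nz[of k] unfolding a
    by (simp add: pderiv_pCons algebra_simps eval_nat_numeral)
  show thesis
  proof (cases "inj (($) x)")
    case True
    then show thesis using that[of 1 1] by (auto simp: inj_def)
  next
    case False
    then obtain i j where ij: "x $ i = x $ j" "i \<noteq> j" by (auto simp: inj_def)
    have "a \<noteq> 0" using dbl[OF ij] b by auto
    show thesis
    proof (rule that[of i j])
      fix k l assume kl: "x $ k = x $ l"
      show "k = l \<or> {k, l} = {i, j}"
      proof (rule disjCI, rule ccontr)
        assume *: "{k, l} \<noteq> {i, j}" "k \<noteq> l"
        have "4 * a * x $ k = 4 * a * x $ i"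
          using dbl[OF ij] dbl[OF kl *(2)] by (metis add_right_cancel)
        then have "x $ k = x $ i" using \<open>a \<noteq> 0\<close> by simp
        moreover have "k \<notin> {i, j} \<or> l \<notin> {i, j}" using * by auto
        ultimately show False using tri[of i j k] tri[of i j l] ij kl by auto
      qed
    qed
  qed
qed

section \<open>Permuting coordinates\<close>

lemma proj_point_eq: "proj_point x = range (\<lambda>c. c *s x)"
  by (rule vec.span_singleton)

lemma proj_point_eq_iff:
  fixes x y :: "complex ^ 'n"
  assumes "x \<noteq> 0" "y \<noteq> 0"
  shows "proj_point y = proj_point x \<longleftrightarrow> (\<exists>c. c \<noteq> 0 \<and> y = c *s x)"
proof
  assume "proj_point y = proj_point x"
  then have "y \<in> proj_point x" by (metis vec.span_base singletonI)
  then show "\<exists>c. c \<noteq> 0 \<and> y = c *s x"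
    using assms by (auto simp: proj_point_eq)
next
  assume "\<exists>c. c \<noteq> 0 \<and> y = c *s x"
  then obtain c where c: "c \<noteq> 0" "y = c *s x" by blast
  have *: "k *s x = (k / c) *s y" "k *s y = (k * c) *s x" for k
    using c by simp_all
  show "proj_point y = proj_point x"
    unfolding proj_point_eq by (rule equalityI; rule image_subsetI) (metis * rangeI)+
qed

lemma permute_coords_nth [simp]: "permute_coords \<sigma> x $ i = x $ \<sigma> i"
  by (simp add: permute_coords_def)

lemma permute_coords_permute_coords:
  "permute_coords \<sigma> (permute_coords \<tau> x) = permute_coords (\<tau> \<circ> \<sigma>) x"
  by (simp add: vec_eq_iff)

lemma permute_coords_id [simp]: "permute_coords id x = x"
  by (simp add: vec_eq_iff)

lemma permute_coords_scale: "permute_coords \<sigma> (c *s x) = c *s permute_coords \<sigma> x"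
  by (simp add: vec_eq_iff)

lemma permute_coords_eq_0_iff:
  assumes "\<sigma> permutes UNIV"
  shows "permute_coords \<sigma> x = 0 \<longleftrightarrow> x = 0"
  using permutes_surj[OF assms] by (simp add: vec_eq_iff) (metis surjD)

lemma permute_proj_point: "permute_coords \<sigma> ` proj_point x = proj_point (permute_coords \<sigma> x)"
  by (simp add: proj_point_eq image_image permute_coords_scale)

lemma bring_curve_iff: "p \<in> bring_curve \<longleftrightarrow> (\<exists>x. p = proj_point x \<and> x \<noteq> 0 \<and> bring_equations x)"
  by (auto simp: bring_curve_def bring_equations_def)

lemma bring_equations_permute:
  assumes "\<sigma> permutes UNIV"
  shows "bring_equations (permute_coords \<sigma> x) \<longleftrightarrow> bring_equations x"
proof -
  have "(\<Sum>i\<in>UNIV. (x $ \<sigma> i) ^ n) = (\<Sum>i\<in>UNIV. (x $ i) ^ n)" for n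
    by (rule sum.permute[OF assms, unfolded o_def, symmetric])
  from this[of 1] this[of 2] this[of 3] show ?thesis
    by (simp add: bring_equations_def)
qed

lemma bring_equations_of_vertex_coords:
  assumes "bij_betw (($) x) UNIV vertex_coords"
  shows "bring_equations x" "x \<noteq> 0"
proof -
  have "(\<Sum>i\<in>UNIV. (x $ i) ^ n) = (\<Sum>z\<in>vertex_coords. z ^ n)" for n
    using sum.reindex_bij_betw[OF assms] .
  from this[of 1] this[of 2] this[of 3] show "bring_equations x"
    by (simp add: bring_equations_def vertex_coords_eq complex_eq_iff)
  show "x \<noteq> 0"
    using assms by (auto simp: bij_betw_def vertex_coords_eq image_iff set_eq_iff)
      (metis zero_neq_one)
qed

definition perm_map :: "(5 \<Rightarrow> 5) \<Rightarrow> (complex ^ 5) set \<Rightarrow> (complex ^ 5) set" where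
  "perm_map \<sigma> = restrict ((`) (permute_coords \<sigma>)) bring_curve"

lemma perm_map_proj_point:
  "proj_point x \<in> bring_curve \<Longrightarrow> perm_map \<sigma> (proj_point x) = proj_point (permute_coords \<sigma> x)"
  by (simp add: perm_map_def permute_proj_point)

lemma perm_map_in_bring_curve:
  assumes "\<sigma> permutes UNIV" "p \<in> bring_curve"
  shows "perm_map \<sigma> p \<in> bring_curve"
proof -
  obtain x where x: "p = proj_point x" "x \<noteq> 0" "bring_equations x"
    using assms(2) bring_curve_iff by blast
  then have "perm_map \<sigma> p = proj_point (permute_coords \<sigma> x)"
    using assms(2) perm_map_proj_point by blast
  with x assms(1) show ?thesis
    unfolding bring_curve_iff using permute_coords_eq_0_iff bring_equations_permute by blast
qed

lemma perm_map_extensional: "perm_map \<sigma> \<in> extensional bring_curve"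
  by (simp add: perm_map_def)

text \<open>Permuting coordinates is precomposition, hence contravariant: the order of the factors is reversed.\<close>

lemma perm_map_comp:
  assumes "\<tau> permutes UNIV" "p \<in> bring_curve"
  shows "perm_map \<sigma> (perm_map \<tau> p) = perm_map (\<tau> \<circ> \<sigma>) p"
  using assms perm_map_in_bring_curve[OF assms]
  by (simp add: perm_map_def image_image permute_coords_permute_coords)

lemma perm_map_id: "p \<in> bring_curve \<Longrightarrow> perm_map id p = p"
  by (simp add: perm_map_def)

lemma perm_map_Bij:
  assumes "\<sigma> permutes UNIV"
  shows "perm_map \<sigma> \<in> Bij bring_curve"
proof -
  note inv = permutes_inv[OF assms] permutes_inv_o[OF assms]
  have "bij_betw (perm_map \<sigma>) bring_curve bring_curve"
    by (rule bij_betw_byWitness[where f' = "perm_map (inv_into UNIV \<sigma>)"])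
      (auto simp: perm_map_comp perm_map_id perm_map_in_bring_curve assms inv)
  then show ?thesis
    by (simp add: Bij_def perm_map_def)
qed

text \<open>The permuted coordinates are linear forms without common zero, so a single tuple serves all points.\<close>

lemma perm_map_regular:
  assumes \<sigma>: "\<sigma> permutes UNIV"
  shows "regular_map_on bring_curve (perm_map \<sigma>)"
  unfolding regular_map_on_def
proof
  fix p assume "p \<in> bring_curve"
  then obtain x where x: "p = proj_point x" "x \<noteq> 0" by (auto simp: bring_curve_iff)
  have "homogeneous_poly 1 (\<lambda>x. permute_coords \<sigma> x $ i)" for i
    by (simp add: homogeneous_poly.coord[simplified])
  with x \<sigma> show "\<exists>d F. (\<forall>i. homogeneous_poly d (\<lambda>x. F x $ i)) \<and>
        (\<exists>x. p = proj_point x \<and> F x \<noteq> 0) \<and>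
        (\<forall>x. proj_point x \<in> bring_curve \<and> F x \<noteq> 0 \<longrightarrow> perm_map \<sigma> (proj_point x) = proj_point (F x))"
    by (intro exI[of _ 1] exI[of _ "permute_coords \<sigma>"])
      (auto simp: perm_map_proj_point permute_coords_eq_0_iff)
qed

lemma restrict_inv_into_perm_map:
  assumes "\<sigma> permutes UNIV"
  shows "restrict (inv_into bring_curve (perm_map \<sigma>)) bring_curve = perm_map (inv_into UNIV \<sigma>)"
proof
  fix p
  show "restrict (inv_into bring_curve (perm_map \<sigma>)) bring_curve p = perm_map (inv_into UNIV \<sigma>) p"
  proof (cases "p \<in> bring_curve")
    case True
    have "inj_on (perm_map \<sigma>) bring_curve"
      using perm_map_Bij[OF assms] by (simp add: Bij_def bij_betw_def)
    moreover have "perm_map \<sigma> (perm_map (inv_into UNIV \<sigma>) p) = p"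
      using True by (simp add: perm_map_comp perm_map_id permutes_inv[OF assms] permutes_inv_o[OF assms])
    ultimately show ?thesis
      using True perm_map_in_bring_curve[OF permutes_inv[OF assms] True]
      by (simp add: inv_into_f_eq)
  qed (simp add: perm_map_def)
qed

lemma coord_perm_maps_eq: "coord_perm_maps = perm_map ` {\<sigma>. \<sigma> permutes UNIV}"
  by (auto simp: coord_perm_maps_def perm_map_def)

lemma coord_perm_maps_subset_aut: "coord_perm_maps \<subseteq> carrier (aut_group bring_curve)"
  by (auto simp: coord_perm_maps_eq aut_group_def perm_map_Bij perm_map_regular
      restrict_inv_into_perm_map permutes_inv)

lemma perm_map_compose:
  assumes "\<tau> permutes UNIV"
  shows "compose bring_curve (perm_map \<sigma>) (perm_map \<tau>) = perm_map (\<tau> \<circ> \<sigma>)"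
  by (rule extensionalityI[of _ bring_curve])
    (auto simp: perm_map_comp[OF assms] compose_eq perm_map_extensional)

lemma perm_map_one: "(\<lambda>x\<in>bring_curve. x) = perm_map id"
  by (rule extensionalityI[of _ bring_curve]) (auto simp: perm_map_id perm_map_extensional simp del: id_apply)

section \<open>The symmetric group acting on Bring's curve\<close>

text \<open>The group of coordinate permutations. It sits inside the automorphism group, and under the
hypothesis of the theorem is all of it; working in this group keeps the lemmas unconditional.\<close>

definition coord_perm_group :: "((complex ^ 5) set \<Rightarrow> (complex ^ 5) set) monoid" where
  "coord_perm_group = BijGroup bring_curve \<lparr>carrier := coord_perm_maps\<rparr>"

lemma carrier_coord_perm_group [simp]: "carrier coord_perm_group = coord_perm_maps"
  by (simp add: coord_perm_group_def)

lemma perm_map_in_coord_perm_maps: "\<sigma> permutes UNIV \<Longrightarrow> perm_map \<sigma> \<in> coord_perm_maps"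
  by (auto simp: coord_perm_maps_eq)

lemma coord_perm_group_one: "\<one>\<^bsub>coord_perm_group\<^esub> = perm_map id"
  by (simp add: coord_perm_group_def BijGroup_def perm_map_one del: restrict_apply)

lemma coord_perm_group_mult:
  assumes "\<sigma> permutes UNIV" "\<tau> permutes UNIV"
  shows "perm_map \<sigma> \<otimes>\<^bsub>coord_perm_group\<^esub> perm_map \<tau> = perm_map (\<tau> \<circ> \<sigma>)"
  by (simp add: coord_perm_group_def BijGroup_def perm_map_Bij assms perm_map_compose)

lemma coord_perm_group_pow:
  assumes "\<sigma> permutes UNIV"
  shows "perm_map \<sigma> [^]\<^bsub>coord_perm_group\<^esub> (n::nat) = perm_map (\<sigma> ^^ n)"
proof (induction n)
  case 0
  then show ?case by (simp add: coord_perm_group_one id_def)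
next
  case (Suc n)
  have "\<sigma> ^^ n permutes UNIV" using assms by (rule permutes_funpow)
  with Suc assms show ?case by (simp add: nat_pow_def coord_perm_group_mult o_def)
qed

lemma permute_coords_funpow:
  "permute_coords \<sigma> x = c *s x \<Longrightarrow> permute_coords (\<sigma> ^^ n) x = c ^ n *s x"
proof (induction n)
  case (Suc n)
  have "permute_coords (\<sigma> ^^ Suc n) x = permute_coords \<sigma> (permute_coords (\<sigma> ^^ n) x)"
    by (simp add: permute_coords_permute_coords funpow_Suc_right del: funpow.simps)
  with Suc show ?case by (simp add: permute_coords_scale mult.commute del: funpow.simps)
qed (simp add: vec_eq_iff)

lemma subgroup_coord_perm_maps: "subgroup coord_perm_maps (BijGroup bring_curve)"
proof (rule group.subgroupI[OF group_BijGroup])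
  show "coord_perm_maps \<subseteq> carrier (BijGroup bring_curve)"
    by (auto simp: coord_perm_maps_eq BijGroup_def perm_map_Bij)
  show "coord_perm_maps \<noteq> {}"
    using perm_map_in_coord_perm_maps[OF permutes_id] by blast
  show "inv\<^bsub>BijGroup bring_curve\<^esub> f \<in> coord_perm_maps" if f: "f \<in> coord_perm_maps" for f
    using f by (auto simp: coord_perm_maps_eq inv_BijGroup perm_map_Bij
        restrict_inv_into_perm_map permutes_inv)
  show "f \<otimes>\<^bsub>BijGroup bring_curve\<^esub> g \<in> coord_perm_maps"
    if "f \<in> coord_perm_maps" "g \<in> coord_perm_maps" for f g
    using that by (auto simp: coord_perm_maps_eq BijGroup_def perm_map_Bij perm_map_compose
        intro!: imageI permutes_compose)
qed

lemma group_coord_perm_group: "group coord_perm_group"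
  unfolding coord_perm_group_def
  using subgroup_coord_perm_maps group_BijGroup by (rule subgroup.subgroup_is_group)

lemma group_action_coord_perm_group: "group_action coord_perm_group bring_curve (\<lambda>f. f)"
  unfolding group_action_def group_hom_def group_hom_axioms_def
  using group_coord_perm_group group_BijGroup subgroup.subset[OF subgroup_coord_perm_maps]
  by (auto simp: hom_def coord_perm_group_def)

lemma aut_group_eq_coord_perm_group:
  assumes "carrier (aut_group bring_curve) \<subseteq> coord_perm_maps"
  shows "aut_group bring_curve = coord_perm_group"
proof -
  have "carrier (aut_group bring_curve) = coord_perm_maps"
    using assms coord_perm_maps_subset_aut by blast
  then show ?thesis
    by (simp add: aut_group_def coord_perm_group_def)
qed

lemma vertex_coords_permute:
  assumes "bij_betw (($) x) UNIV vertex_coords" "\<sigma> permutes UNIV"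
  shows "bij_betw (($) (permute_coords \<sigma> x)) UNIV vertex_coords"
proof -
  have "($) (permute_coords \<sigma> x) = ($) x \<circ> \<sigma>" by (simp add: fun_eq_iff)
  then show ?thesis
    using bij_betw_trans[OF permutes_imp_bij[OF assms(2)] assms(1)] by simp
qed

text \<open>The action is faithful, so the group has order \<open>120\<close> and the order of an automorphism is that of
its permutation. A vertex has exactly one coordinate zero, and its position survives scaling; placing
the zero at position \<open>\<sigma> m\<close> recovers \<open>\<sigma> m\<close> from the induced map.\<close>

lemma perm_map_inj: "inj_on perm_map {\<sigma>. \<sigma> permutes UNIV}"
proof (rule inj_onI, safe, rule ext)
  fix \<sigma> \<pi> :: "5 \<Rightarrow> 5" and m
  assume perm: "\<sigma> permutes UNIV" "\<pi> permutes UNIV" and eq: "perm_map \<sigma> = perm_map \<pi>"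
  define v :: "complex ^ 5" where "v = vector [1, \<i>, -1, -\<i>, 0]"
  have v: "bij_betw (($) v) UNIV vertex_coords"
    using bring_vector_coords[OF v_def] .
  then have "0 \<in> ($) v ` UNIV"
    by (simp add: bij_betw_def vertex_coords_def)
  then obtain k where k: "v $ k = 0" by (metis imageE)
  define x where "x = permute_coords (Transposition.transpose (\<sigma> m) k) v"
  have x: "bij_betw (($) x) UNIV vertex_coords"
    unfolding x_def using v by (rule vertex_coords_permute) (simp add: permutes_swap_id)
  note x' = bring_equations_of_vertex_coords[OF x]
  have "proj_point x \<in> bring_curve" using x' bring_curve_iff by blast
  then have "proj_point (permute_coords \<pi> x) = proj_point (permute_coords \<sigma> x)"
    using eq perm_map_proj_point by metis
  then obtain c where "permute_coords \<pi> x = c *s permute_coords \<sigma> x"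
    using x' perm proj_point_eq_iff permute_coords_eq_0_iff by metis
  then have "permute_coords \<pi> x $ m = c * permute_coords \<sigma> x $ m"
    by simp
  moreover have x0: "x $ \<sigma> m = 0" by (simp add: x_def k)
  ultimately have "x $ \<sigma> m = x $ \<pi> m" by simp
  then show "\<sigma> m = \<pi> m"
    using x by (simp add: bij_betw_def inj_def)
qed

lemma perm_map_pow_eq_one_iff:
  assumes "\<sigma> permutes UNIV"
  shows "perm_map \<sigma> [^]\<^bsub>coord_perm_group\<^esub> (n::nat) = \<one>\<^bsub>coord_perm_group\<^esub> \<longleftrightarrow> \<sigma> ^^ n = id"
  using inj_on_eq_iff[OF perm_map_inj, of "\<sigma> ^^ n" id] assms
  by (simp add: coord_perm_group_pow coord_perm_group_one permutes_funpow permutes_id)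

lemma card_coord_perm_maps: "card coord_perm_maps = 120"
  using card_permutations[of "UNIV :: 5 set" 5] perm_map_inj
  by (simp add: coord_perm_maps_eq card_image fact_numeral)

text \<open>The stabilizer of the point \<open>[x]\<close>, pulled back to permutations of the index set; such a permutation
comes with the factor \<open>c\<close> by which it scales \<open>x\<close>.\<close>

definition proj_stabilizer :: "complex ^ 5 \<Rightarrow> (5 \<Rightarrow> 5) set" where
  "proj_stabilizer x = {\<sigma>. \<sigma> permutes UNIV \<and> (\<exists>c. permute_coords \<sigma> x = c *s x)}"

lemma perm_map_fixes_iff:
  assumes "\<sigma> permutes UNIV" "proj_point x \<in> bring_curve" "x \<noteq> 0"
  shows "perm_map \<sigma> (proj_point x) = proj_point x \<longleftrightarrow> \<sigma> \<in> proj_stabilizer x"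
proof -
  have nz: "permute_coords \<sigma> x \<noteq> 0" using assms permute_coords_eq_0_iff by blast
  then have "c \<noteq> 0" if "permute_coords \<sigma> x = c *s x" for c using that by auto
  then show ?thesis
    using assms proj_point_eq_iff[OF assms(3) nz]
    by (auto simp: perm_map_proj_point proj_stabilizer_def)
qed

lemma stabilizer_eq:
  assumes "proj_point x \<in> bring_curve" "x \<noteq> 0"
  shows "stabilizer coord_perm_group (\<lambda>f. f) (proj_point x) = perm_map ` proj_stabilizer x"
  using perm_map_fixes_iff[OF _ assms]
  by (auto simp: stabilizer_def coord_perm_maps_eq) (auto simp: proj_stabilizer_def)

lemma card_stabilizer:
  assumes "proj_point x \<in> bring_curve" "x \<noteq> 0"
  shows "card (stabilizer coord_perm_group (\<lambda>f. f) (proj_point x)) = card (proj_stabilizer x)"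
  unfolding stabilizer_eq[OF assms]
  by (intro card_image inj_on_subset[OF perm_map_inj]) (auto simp: proj_stabilizer_def)

lemma card_orbit_eq_30_iff:
  assumes "proj_point x \<in> bring_curve" "x \<noteq> 0"
  shows "card (orbit coord_perm_group (\<lambda>f. f) (proj_point x)) = 30 \<longleftrightarrow> card (proj_stabilizer x) = 4"
proof -
  have "card (orbit coord_perm_group (\<lambda>f. f) (proj_point x)) * card (proj_stabilizer x) = 120"
    using group_action.orbit_stabilizer_theorem[OF group_action_coord_perm_group assms(1)]
    by (simp add: card_stabilizer[OF assms] order_def card_coord_perm_maps)
  then show ?thesis by auto
qed

section \<open>Stabilizers\<close>

lemma multiplication_is_permutation:
  assumes "bij_betw (($) x) UNIV vertex_coords" "z \<in> vertex_coords" "z \<noteq> 0"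
  obtains \<sigma> where "\<sigma> permutes UNIV" "permute_coords \<sigma> x = z *s x"
proof -
  have z4: "z ^ 4 = 1"
    using assms(2,3) by (auto simp: vertex_coords_def eval_nat_numeral)
  have in_roots: "z * x $ k \<in> vertex_coords" for k
    using assms(1,2) by (auto simp: bij_betw_def vertex_coords_def power_mult_distrib)
  have "\<exists>l. x $ l = z * x $ k" for k
    using in_roots[of k] assms(1) by (metis bij_betw_def imageE)
  then obtain \<sigma> where \<sigma>: "\<And>k. x $ \<sigma> k = z * x $ k" by metis
  have "inj \<sigma>"
  proof (rule injI)
    fix k l assume "\<sigma> k = \<sigma> l"
    then have "z * x $ k = z * x $ l" by (metis \<sigma>)
    then show "k = l" using assms(1,3) by (simp add: bij_betw_def inj_def)
  qed
  then have "\<sigma> permutes UNIV"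
    by (simp add: finite_UNIV_inj_surj permutes_univ bij_def flip: bij_iff)
  then show thesis
    by (rule that) (simp add: vec_eq_iff \<sigma>)
qed

text \<open>Since the coordinates are distinct, a stabilizing permutation is determined by its factor, and the
possible factors are the nonzero elements of \<^const>\<open>vertex_coords\<close>. The factor is read off as
\<open>x $ \<sigma> m\<close> at the position \<open>m\<close> of the coordinate \<open>1\<close>.\<close>

lemma card_proj_stabilizer_vertex:
  assumes x: "bij_betw (($) x) UNIV vertex_coords"
  shows "card (proj_stabilizer x) = 4"
proof -
  have inj: "x $ k = x $ l \<Longrightarrow> k = l" for k l using x by (simp add: bij_betw_def inj_def)
  have in_roots: "x $ k \<in> vertex_coords" for k using x by (auto simp: bij_betw_def)
  have "1 \<in> ($) x ` UNIV" using x by (simp add: bij_betw_def vertex_coords_def)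
  then obtain m where m: "x $ m = 1" by (metis imageE)
  have stab: "permute_coords \<sigma> x = x $ \<sigma> m *s x" if \<sigma>: "\<sigma> \<in> proj_stabilizer x" for \<sigma>
  proof -
    obtain c where c: "permute_coords \<sigma> x = c *s x"
      using \<sigma> by (auto simp: proj_stabilizer_def)
    then have "x $ \<sigma> m = c * x $ m"
      by (metis permute_coords_nth vector_smult_component)
    with c show ?thesis by (simp add: m)
  qed
  have "bij_betw (\<lambda>\<sigma>. x $ \<sigma> m) (proj_stabilizer x) (vertex_coords - {0})"
    unfolding bij_betw_def
  proof
    show "inj_on (\<lambda>\<sigma>. x $ \<sigma> m) (proj_stabilizer x)"
    proof (rule inj_onI, rule ext)
      fix \<sigma> \<tau> k
      assume "\<sigma> \<in> proj_stabilizer x" "\<tau> \<in> proj_stabilizer x" "x $ \<sigma> m = x $ \<tau> m"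
      then have "permute_coords \<sigma> x = permute_coords \<tau> x" by (metis stab)
      then have "x $ \<sigma> k = x $ \<tau> k" by (metis permute_coords_nth)
      then show "\<sigma> k = \<tau> k" by (rule inj)
    qed
    show "(\<lambda>\<sigma>. x $ \<sigma> m) ` proj_stabilizer x = vertex_coords - {0}"
    proof (intro equalityI subsetI)
      fix z assume "z \<in> (\<lambda>\<sigma>. x $ \<sigma> m) ` proj_stabilizer x"
      then obtain \<sigma> where \<sigma>: "\<sigma> \<in> proj_stabilizer x" "z = x $ \<sigma> m" by blast
      have "permute_coords \<sigma> x \<noteq> 0"
        using \<sigma>(1) bring_equations_of_vertex_coords(2)[OF x] permute_coords_eq_0_iff
        by (auto simp: proj_stabilizer_def)
      then have "z \<noteq> 0" using stab[OF \<sigma>(1)] \<sigma>(2) by auto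
      then show "z \<in> vertex_coords - {0}" using in_roots \<sigma>(2) by simp
    next
      fix z assume "z \<in> vertex_coords - {0}"
      then obtain \<sigma> where \<sigma>: "\<sigma> permutes UNIV" "permute_coords \<sigma> x = z *s x"
        using multiplication_is_permutation[OF x] by auto
      then have "x $ \<sigma> m = z" by (metis permute_coords_nth vector_smult_component m mult.right_neutral)
      moreover have "\<sigma> \<in> proj_stabilizer x" using \<sigma> by (auto simp: proj_stabilizer_def)
      ultimately show "z \<in> (\<lambda>\<sigma>. x $ \<sigma> m) ` proj_stabilizer x" by blast
    qed
  qed
  then have "card (proj_stabilizer x) = card (vertex_coords - {0})"
    by (rule bij_betw_same_card)
  also have "\<dots> = 4"
    by (simp add: card_vertex_coords card_Diff_singleton zero_in_vertex_coords)
  finally show ?thesis .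
qed

text \<open>The permutation that multiplies all coordinates by \<open>\<i>\<close> has the order of \<open>\<i>\<close>, because the
coordinates are distinct.\<close>

lemma vertex_fixed_by_order_4:
  assumes x: "bij_betw (($) x) UNIV vertex_coords"
  obtains f where "f \<in> coord_perm_maps" "group.ord coord_perm_group f = 4"
    "f (proj_point x) = proj_point x"
proof -
  interpret group coord_perm_group by (rule group_coord_perm_group)
  have inj: "x $ k = x $ l \<Longrightarrow> k = l" for k l using x by (simp add: bij_betw_def inj_def)
  have "\<i> \<in> vertex_coords" by (simp add: vertex_coords_eq)
  then obtain \<sigma> where \<sigma>: "\<sigma> permutes UNIV" "permute_coords \<sigma> x = \<i> *s x"
    using multiplication_is_permutation[OF x] by (metis complex_i_not_zero)
  have pow: "permute_coords (\<sigma> ^^ n) x = \<i> ^ n *s x" for n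
    by (rule permute_coords_funpow[OF \<sigma>(2)])
  let ?f = "perm_map \<sigma>"
  have f: "?f \<in> carrier coord_perm_group" using \<sigma>(1) by (simp add: perm_map_in_coord_perm_maps)
  have pow_id: "?f [^]\<^bsub>coord_perm_group\<^esub> n = \<one>\<^bsub>coord_perm_group\<^esub> \<longleftrightarrow> \<i> ^ n = 1" for n
  proof -
    have "?f [^]\<^bsub>coord_perm_group\<^esub> n = \<one>\<^bsub>coord_perm_group\<^esub> \<longleftrightarrow> \<sigma> ^^ n = id"
      using \<sigma>(1) by (rule perm_map_pow_eq_one_iff)
    also have "\<dots> \<longleftrightarrow> permute_coords (\<sigma> ^^ n) x = x"
      by (auto simp: vec_eq_iff fun_eq_iff dest: inj)
    also have "\<dots> \<longleftrightarrow> \<i> ^ n = 1"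
      using bring_equations_of_vertex_coords(2)[OF x] unfolding pow by (auto simp: vec_eq_iff)
    finally show ?thesis .
  qed
  have "ord ?f dvd 4" "\<not> ord ?f dvd 2"
    using pow_id[of 4] pow_id[of 2] by (simp_all add: pow_eq_id[OF f, symmetric])
  moreover from this(1) have "ord ?f \<le> 4" by (rule dvd_imp_le) simp
  then have "ord ?f = 0 \<or> ord ?f = 1 \<or> ord ?f = 2 \<or> ord ?f = 3 \<or> ord ?f = 4" by linarith
  ultimately have "ord ?f = 4" by auto
  moreover have "?f (proj_point x) = proj_point x"
    using perm_map_fixes_iff[OF \<sigma>(1)] bring_equations_of_vertex_coords[OF x] \<sigma>
    by (auto simp: bring_curve_iff proj_stabilizer_def)
  ultimately show thesis using that f by simp
qed

text \<open>The factor \<open>c\<close> of \<open>\<sigma>\<close> satisfies \<open>c ^ 5 = 1\<close>, since the product of the coordinates is invariant and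
nonzero, and \<open>c ^ 4 = 1\<close>, since \<open>\<sigma> ^^ 4 = id\<close>. So \<open>c = 1\<close>: the permutation moves no coordinate to a
different value, and can at most exchange the single pair of equal coordinates.\<close>

lemma nonvertex_stabilizer:
  assumes x: "bring_equations x" "(\<Prod>i\<in>UNIV. x $ i) \<noteq> 0"
  obtains i j where
    "\<And>\<sigma>. \<sigma> \<in> proj_stabilizer x \<Longrightarrow> \<sigma> ^^ 4 = id \<Longrightarrow> \<sigma> = id \<or> \<sigma> = Transposition.transpose i j"
proof -
  obtain i j where ij: "\<And>k l. x $ k = x $ l \<Longrightarrow> k = l \<or> {k, l} = {i, j}"
    using nonzero_coords_at_most_one_coincidence[OF x] by blast
  have nz: "x $ k \<noteq> 0" for k using x(2) by auto
  show thesis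
  proof (rule that[of i j])
    fix \<sigma> assume \<sigma>: "\<sigma> \<in> proj_stabilizer x" "\<sigma> ^^ 4 = id"
    then obtain c where perm: "\<sigma> permutes UNIV" and c: "permute_coords \<sigma> x = c *s x"
      by (auto simp: proj_stabilizer_def)
    have "x = c ^ 4 *s x"
      using permute_coords_funpow[OF c, of 4] \<sigma>(2) by simp
    then have "x $ i = c ^ 4 * x $ i" by (metis vector_smult_component)
    then have c4: "c ^ 4 = 1" using nz by simp
    have "(\<Prod>i\<in>UNIV. x $ i) = (\<Prod>i\<in>UNIV. x $ \<sigma> i)"
      by (rule prod.permute[OF perm, unfolded o_def])
    also have "\<dots> = (\<Prod>i\<in>UNIV. c * x $ i)"
      using c by (simp add: vec_eq_iff)
    also have "\<dots> = c ^ 5 * (\<Prod>i\<in>UNIV. x $ i)"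
      by (simp add: prod.distrib)
    finally have "c ^ 5 = 1" using x(2) by simp
    then have "c = 1" using c4 by (simp add: eval_nat_numeral)
    then have fixed: "x $ \<sigma> k = x $ k" for k using c by (simp add: vec_eq_iff)
    have move: "\<sigma> k = k \<or> {\<sigma> k, k} = {i, j}" for k using ij[OF fixed] .
    have inj: "\<sigma> k = \<sigma> l \<Longrightarrow> k = l" for k l
      using permutes_inj[OF perm] by (simp add: inj_def)
    show "\<sigma> = id \<or> \<sigma> = Transposition.transpose i j"
    proof (cases "\<sigma> i = i")
      case True
      have "\<sigma> k = k" for k
        using move[of k] inj[of i k] inj[of j i] move[of i] True
        by (auto simp: doubleton_eq_iff)
      then show ?thesis by (auto simp: fun_eq_iff)
    next
      case False
      then have "\<sigma> i = j" using move[of i] by (auto simp: doubleton_eq_iff)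
      moreover from this have "\<sigma> j = i"
        using move[of j] inj[of i j] False by (auto simp: doubleton_eq_iff)
      moreover have "\<sigma> k = k" if "k \<noteq> i" "k \<noteq> j" for k
        using move[of k] that by (auto simp: doubleton_eq_iff)
      ultimately show ?thesis
        by (auto simp: fun_eq_iff Transposition.transpose_def)
    qed
  qed
qed

section \<open>The three descriptions of the vertices\<close>

lemma permuted_bring_vector_iff:
  fixes x :: "complex ^ 5"
  shows "(\<exists>\<sigma>. \<sigma> permutes UNIV \<and> x = permute_coords \<sigma> (vector [1, \<i>, -1, -\<i>, 0]))
    \<longleftrightarrow> bij_betw (($) x) UNIV vertex_coords"
proof -
  define v :: "complex ^ 5" where "v = vector [1, \<i>, -1, -\<i>, 0]"
  have v: "bij_betw (($) v) UNIV vertex_coords"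
    using bring_vector_coords[OF v_def] .
  have "\<exists>\<sigma>. \<sigma> permutes UNIV \<and> x = permute_coords \<sigma> v" if x: "bij_betw (($) x) UNIV vertex_coords"
  proof -
    let ?\<sigma> = "inv_into UNIV (($) v) \<circ> ($) x"
    have "bij ?\<sigma>"
      by (rule bij_betw_trans[OF x bij_betw_inv_into[OF v]])
    then have "?\<sigma> permutes UNIV" by (rule bij_imp_permutes) simp
    moreover have "x $ k \<in> range (($) v)" for k
      using x v by (auto simp: bij_betw_def)
    then have "x = permute_coords ?\<sigma> v"
      by (simp add: vec_eq_iff f_inv_into_f)
    ultimately show ?thesis by blast
  qed
  then show ?thesis
    unfolding v_def[symmetric] using vertex_coords_permute[OF v] by blast
qed

lemma bring_curve_dichotomy:
  assumes "p \<in> bring_curve"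
  obtains (vertex) x where "p = proj_point x" "bij_betw (($) x) UNIV vertex_coords"
  | (nonvertex) x where "p = proj_point x" "bring_equations x" "(\<Prod>i\<in>UNIV. x $ i) \<noteq> 0"
proof -
  obtain x where x: "p = proj_point x" "x \<noteq> 0" "bring_equations x"
    using assms bring_curve_iff by blast
  show thesis
  proof (cases "(\<Prod>i\<in>UNIV. x $ i) = 0")
    case True
    then obtain c where c: "c \<noteq> 0" "bij_betw (($) (c *s x)) UNIV vertex_coords"
      using zero_coord_imp_vertex x by blast
    moreover have "proj_point (c *s x) = p"
      using x(2) c(1) unfolding x(1) by (subst proj_point_eq_iff) auto
    ultimately show thesis using vertex by metis
  qed (use x nonvertex in blast)
qed

text \<open>Lagrange's theorem for the stabilizer; with a stabilizer of order \<open>4\<close> it provides the hypothesis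
\<open>\<sigma> ^^ 4 = id\<close> of the preceding lemma without knowing whether the stabilizer is cyclic.\<close>

lemma stabilizer_pow_card:
  assumes "p \<in> bring_curve" "f \<in> stabilizer coord_perm_group (\<lambda>f. f) p"
  shows "f [^]\<^bsub>coord_perm_group\<^esub> card (stabilizer coord_perm_group (\<lambda>f. f) p) = \<one>\<^bsub>coord_perm_group\<^esub>"
proof -
  interpret group_action coord_perm_group bring_curve "\<lambda>f. f"
    by (rule group_action_coord_perm_group)
  let ?H = "stabilizer coord_perm_group (\<lambda>f. f) p"
  have "group (coord_perm_group \<lparr>carrier := ?H\<rparr>)"
    by (rule subgroup.subgroup_is_group[OF stabilizer_subgroup[OF assms(1)] group_coord_perm_group])
  from group.pow_order_eq_1[OF this, of f] show ?thesis
    using assms(2) by (simp add: order_def nat_pow_def)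
qed

text \<open>On the vertices both properties were shown directly. At any other point, an orbit of size \<open>30\<close> (a
stabilizer of order \<open>4\<close>) and an automorphism of order \<open>4\<close> fixing the point both lead to stabilizing
permutations \<open>\<sigma>\<close> with \<open>\<sigma> ^^ 4 = id\<close>. These are at most the identity and one transposition, too few
for the first and of too small order for the second.\<close>

lemma bring_curve_orbit_30_iff_fixed_iff_vertex:
  assumes p: "p \<in> bring_curve"
  shows "card (orbit coord_perm_group (\<lambda>f. f) p) = 30 \<longleftrightarrow>
          (\<exists>x. p = proj_point x \<and> bij_betw (($) x) UNIV vertex_coords)" (is "?orbit \<longleftrightarrow> ?vertex")
    and "(\<exists>f\<in>coord_perm_maps. group.ord coord_perm_group f = 4 \<and> f p = p) \<longleftrightarrow>
          (\<exists>x. p = proj_point x \<and> bij_betw (($) x) UNIV vertex_coords)" (is "?fixed \<longleftrightarrow> _")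
proof -
  interpret group coord_perm_group by (rule group_coord_perm_group)
  have v: "?orbit \<and> ?fixed" if vertex: ?vertex
  proof -
    obtain x where x: "p = proj_point x" "bij_betw (($) x) UNIV vertex_coords"
      using vertex by blast
    have "?orbit"
      using card_orbit_eq_30_iff p card_proj_stabilizer_vertex[OF x(2)]
        bring_equations_of_vertex_coords(2)[OF x(2)] unfolding x(1) by blast
    then show ?thesis using vertex_fixed_by_order_4[OF x(2)] x(1) by blast
  qed
  have nv: "\<not> ?orbit \<and> \<not> ?fixed" if "\<not> ?vertex"
    using p
  proof (cases rule: bring_curve_dichotomy)
    case (vertex x)
    then show ?thesis using that by blast
  next
    case (nonvertex x)
    note x = nonvertex
    have x0: "x \<noteq> 0" using x(3) by auto
    obtain i j where ij:
      "\<And>\<sigma>. \<sigma> \<in> proj_stabilizer x \<Longrightarrow> \<sigma> ^^ 4 = id \<Longrightarrow> \<sigma> = id \<or> \<sigma> = Transposition.transpose i j"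
      using nonvertex_stabilizer[OF x(2,3)] by blast
    have pow_id: "perm_map \<sigma> [^]\<^bsub>coord_perm_group\<^esub> n = \<one>\<^bsub>coord_perm_group\<^esub> \<longleftrightarrow> \<sigma> ^^ n = id"
      if "\<sigma> permutes UNIV" for \<sigma> and n :: nat
      using that by (rule perm_map_pow_eq_one_iff)
    have "\<not> ?orbit"
    proof
      assume ?orbit
      then have card4: "card (proj_stabilizer x) = 4"
        using card_orbit_eq_30_iff p x0 x(1) by blast
      have "\<sigma> ^^ 4 = id" if "\<sigma> \<in> proj_stabilizer x" for \<sigma>
        using stabilizer_pow_card[of p "perm_map \<sigma>"] p that pow_id[of \<sigma> 4] x(1) x0
          stabilizer_eq[of x] card_stabilizer[of x] card4
        by (auto simp: proj_stabilizer_def)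
      then have "proj_stabilizer x \<subseteq> {id, Transposition.transpose i j}" using ij by blast
      then have "card (proj_stabilizer x) \<le> card {id, Transposition.transpose i j}"
        by (intro card_mono) simp_all
      also have "\<dots> \<le> 2" by (simp add: card_insert_if)
      finally show False using card4 by simp
    qed
    moreover have "\<not> ?fixed"
    proof
      assume ?fixed
      then obtain \<sigma> where \<sigma>: "\<sigma> permutes UNIV" "ord (perm_map \<sigma>) = 4" "perm_map \<sigma> p = p"
        by (auto simp: coord_perm_maps_eq)
      have f: "perm_map \<sigma> \<in> carrier coord_perm_group"
        using \<sigma>(1) by (simp add: perm_map_in_coord_perm_maps)
      have "\<sigma> ^^ 4 = id"
        using pow_eq_id[OF f, of 4] pow_id[OF \<sigma>(1)] \<sigma>(2) by simp
      moreover have "\<sigma> \<in> proj_stabilizer x"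
        using perm_map_fixes_iff[OF \<sigma>(1)] \<sigma>(3) p x0 unfolding x(1) by blast
      ultimately have "\<sigma> ^^ 2 = id"
        using ij[of \<sigma>] by (auto simp: numeral_2_eq_2)
      then have "ord (perm_map \<sigma>) dvd 2"
        using pow_eq_id[OF f, of 2] pow_id[OF \<sigma>(1)] by simp
      then show False using \<sigma>(2) by simp
    qed
    ultimately show ?thesis ..
  qed
  from v nv show "?orbit \<longleftrightarrow> ?vertex" "?fixed \<longleftrightarrow> ?vertex" by blast+
qed

theorem proposition3p9:
  assumes aut_S5: "carrier (aut_group bring_curve) \<subseteq> coord_perm_maps"
  shows "bring_vertices =
           {p \<in> bring_curve. \<exists>f \<in> carrier (aut_group bring_curve).
              group.ord (aut_group bring_curve) f = 4 \<and> f p = p} \<and>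
         bring_vertices =
           {proj_point (permute_coords \<sigma> (vector [1, \<i>, -1, -\<i>, 0])) | \<sigma>. \<sigma> permutes UNIV}"
proof -
  note key = bring_curve_orbit_30_iff_fixed_iff_vertex
  have vertices: "bring_vertices = {p \<in> bring_curve. \<exists>x. p = proj_point x \<and> bij_betw (($) x) UNIV vertex_coords}"
    using key(1) by (auto simp: bring_vertices_def aut_group_eq_coord_perm_group[OF aut_S5])
  also have "\<dots> = {proj_point x | x. bij_betw (($) x) UNIV vertex_coords}"
    using bring_equations_of_vertex_coords bring_curve_iff by blast
  also have "\<dots> = {proj_point (permute_coords \<sigma> (vector [1, \<i>, -1, -\<i>, 0])) | \<sigma>. \<sigma> permutes UNIV}"
    unfolding permuted_bring_vector_iff[symmetric] by blast
  finally have "bring_vertices = {proj_point (permute_coords \<sigma> (vector [1, \<i>, -1, -\<i>, 0])) | \<sigma>. \<sigma> permutes UNIV}" .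
  moreover have "bring_vertices = {p \<in> bring_curve. \<exists>f \<in> carrier (aut_group bring_curve).
      group.ord (aut_group bring_curve) f = 4 \<and> f p = p}"
    unfolding vertices aut_group_eq_coord_perm_group[OF aut_S5] carrier_coord_perm_group
    using key(2) by blast
  ultimately show ?thesis by blast
qed

end
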